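(* $\mathrm{Parity}$ reduces to $\mathrm{BGGM}$ in $\mathrm{AC}^0$.
   Context: $\mathrm{Parity}=\{x\in\{0,1\}^*: \text{the number of 1's in } x \text{ is odd}\}$. A grid layered planar graph is a planar graph embedded in the integer lattice such that every edge joins lattice points $(a,b),(c,d)$ with $|a-c|\le1$; its length and width are its numbers of columns and rows. $\mathrm{BGGM}$ is the language of (encodings of) bipartite grid layered planar graphs, given together with their lattice embedding (i.e., which lattice points are vertices and which pairs of points are edges), that have a perfect matching. $\mathrm{AC}^0$ is the class of languages decided by (non-uniform) families of constant-depth, polynomial-size circuits with unbounded fan-in AND, OR and NOT gates; an $\mathrm{AC}^0$ reduction from $L$ to $L'$ is such a circuit family which may additionally use oracle gates for $L'$ and decides $L$. *)

theory Defs
  imports "HOL-Analysis.Analysis" "HOL-Computational_Algebra.Polynomial"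
begin

section \<open>Languages\<close>

type_synonym language = "bool list set"

definition Parity :: language where
  "Parity = {x. odd (count_list x True)}"

section \<open>Bipartite grid layered planar graphs with perfect matchings\<close>

text \<open>A graph is given by a vertex set and a set of two-element sets of vertices. The first
  coordinate of a lattice point is its column, the second one its row.\<close>

type_synonym point = "int \<times> int"

definition simple_graph :: "'a set \<Rightarrow> 'a set set \<Rightarrow> bool" where
  "simple_graph V E \<longleftrightarrow> finite V \<and> (\<forall>e\<in>E. e \<subseteq> V \<and> card e = 2)"

definition bipartite :: "'a set \<Rightarrow> 'a set set \<Rightarrow> bool" where
  "bipartite V E \<longleftrightarrow>
     (\<exists>A B. A \<union> B = V \<and> A \<inter> B = {} \<and> (\<forall>e\<in>E. \<exists>a\<in>A. \<exists>b\<in>B. e = {a, b}))"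

definition perfect_matching :: "'a set \<Rightarrow> 'a set set \<Rightarrow> 'a set set \<Rightarrow> bool" where
  "perfect_matching V E M \<longleftrightarrow> M \<subseteq> E \<and> (\<forall>v\<in>V. \<exists>!e. e \<in> M \<and> v \<in> e)"

definition plane_point :: "point \<Rightarrow> real \<times> real" where
  "plane_point p = (real_of_int (fst p), real_of_int (snd p))"

text \<open>Since the embedding is specified by the endpoints of the edges, edges are drawn as straight
  line segments; \<^term>\<open>segment e\<close> is the closed segment between the endpoints of \<^term>\<open>e\<close>
  (cf. \<open>segment_convex_hull\<close>).\<close>

definition segment :: "point set \<Rightarrow> (real \<times> real) set" where
  "segment e = convex hull (plane_point ` e)"

definition planar_embedded :: "point set \<Rightarrow> point set set \<Rightarrow> bool" where
  "planar_embedded V E \<longleftrightarrow>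
     (\<forall>e\<in>E. \<forall>f\<in>E. e \<noteq> f \<longrightarrow> segment e \<inter> segment f \<subseteq> plane_point ` (e \<inter> f)) \<and>
     (\<forall>e\<in>E. \<forall>v\<in>V. plane_point v \<in> segment e \<longrightarrow> v \<in> e)"

definition grid_layered_planar :: "point set \<Rightarrow> point set set \<Rightarrow> bool" where
  "grid_layered_planar V E \<longleftrightarrow>
     simple_graph V E \<and> planar_embedded V E \<and>
     (\<forall>e\<in>E. \<forall>p\<in>e. \<forall>q\<in>e. \<bar>fst p - fst q\<bar> \<le> 1)"

text \<open>The lattice points of the grid with \<open>l\<close> columns and \<open>w\<close> rows, column by column.\<close>

definition grid_points :: "nat \<Rightarrow> nat \<Rightarrow> point list" where
  "grid_points l w = List.product (map int [0..<l]) (map int [0..<w])"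

text \<open>The encoding consists of length and width in unary, one bit for each lattice point of the
  grid, and the adjacency matrix over the lattice points. The unary header makes it uniquely
  decodable.\<close>

definition encode_grid_graph ::
    "nat \<Rightarrow> nat \<Rightarrow> point set \<Rightarrow> point set set \<Rightarrow> bool list" where
  "encode_grid_graph l w V E =
     replicate l True @ [False] @ replicate w True @ [False] @
     map (\<lambda>p. p \<in> V) (grid_points l w) @
     map (\<lambda>(p, q). {p, q} \<in> E) (List.product (grid_points l w) (grid_points l w))"

definition BGGM :: language where
  "BGGM = {encode_grid_graph l w V E | l w V E.
     V \<subseteq> set (grid_points l w) \<and> grid_layered_planar V E \<and> bipartite V E \<and>
     (\<exists>M. perfect_matching V E M)}"

section \<open>Oracle circuits\<close>

text \<open>A circuit on \<open>n\<close> inputs is a directed acyclic graph, given as a list of gates in topological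
  order: wires \<open>0, \<dots>, n - 1\<close> are the inputs, and wire \<open>n + i\<close> carries the output of gate \<open>i\<close>.
  The constants are the AND and the OR gate of fan-in 0.\<close>

datatype gate =
    AndGate "nat list"
  | OrGate "nat list"
  | NotGate nat
  | OracleGate "nat list"

fun gate_inputs :: "gate \<Rightarrow> nat list" where
  "gate_inputs (AndGate ws) = ws"
| "gate_inputs (OrGate ws) = ws"
| "gate_inputs (NotGate w) = [w]"
| "gate_inputs (OracleGate ws) = ws"

record circuit =
  gates :: "gate list"
  output_wire :: nat

definition wf_circuit :: "nat \<Rightarrow> circuit \<Rightarrow> bool" where
  "wf_circuit n C \<longleftrightarrow>
     (\<forall>i < length (gates C). \<forall>w \<in> set (gate_inputs (gates C ! i)). w < n + i) \<and>
     output_wire C < n + length (gates C)"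

fun gate_value :: "language \<Rightarrow> bool list \<Rightarrow> gate \<Rightarrow> bool" where
  "gate_value L vs (AndGate ws) = (\<forall>w \<in> set ws. vs ! w)"
| "gate_value L vs (OrGate ws) = (\<exists>w \<in> set ws. vs ! w)"
| "gate_value L vs (NotGate w) = (\<not> vs ! w)"
| "gate_value L vs (OracleGate ws) = (map ((!) vs) ws \<in> L)"

definition wire_values :: "language \<Rightarrow> circuit \<Rightarrow> bool list \<Rightarrow> bool list" where
  "wire_values L C x = foldl (\<lambda>vs g. vs @ [gate_value L vs g]) x (gates C)"

definition accepts :: "language \<Rightarrow> circuit \<Rightarrow> bool list \<Rightarrow> bool" where
  "accepts L C x \<longleftrightarrow> wire_values L C x ! output_wire C"

text \<open>Gates of every kind, including NOT and oracle gates, count towards the depth.\<close>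

definition wire_depths :: "nat \<Rightarrow> circuit \<Rightarrow> nat list" where
  "wire_depths n C =
     foldl (\<lambda>ds g. ds @ [Suc (Max (insert 0 ((!) ds ` set (gate_inputs g))))])
       (replicate n 0) (gates C)"

definition circuit_depth :: "nat \<Rightarrow> circuit \<Rightarrow> nat" where
  "circuit_depth n C = Max (insert 0 (set (wire_depths n C)))"

text \<open>The size is the number of gates plus the number of wires entering gates, so that a polynomial
  size bound also bounds the length of the oracle queries.\<close>

definition circuit_size :: "circuit \<Rightarrow> nat" where
  "circuit_size C = (\<Sum>g\<leftarrow>gates C. 1 + length (gate_inputs g))"

definition AC0_reduces :: "language \<Rightarrow> language \<Rightarrow> bool" where
  "AC0_reduces L L' \<longleftrightarrow>
     (\<exists>(C :: nat \<Rightarrow> circuit) (d :: nat) (p :: nat poly). \<forall>n.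
        wf_circuit n (C n) \<and>
        circuit_depth n (C n) \<le> d \<and>
        circuit_size (C n) \<le> poly p n \<and>
        (\<forall>x. length x = n \<longrightarrow> (x \<in> L \<longleftrightarrow> accepts L' (C n) x)))"

end

theory Submission
  imports Defs
begin

text \<open>A path has a perfect matching iff its number of vertices is even. On input \<open>x\<close> of length \<open>n\<close>
  take a path in a single lattice column: it visits all even rows \<open>0, 2, \<dots>, 2 n\<close>, and it visits
  row \<open>2 i + 1\<close> iff \<open>x ! i\<close> is false. The number of its vertices is \<open>2 n + 1\<close> minus the number of
  ones. Which vertices and edges are present is decided bit by bit: each bit of the
  encoding is a constant, an input bit or a negated input bit, so a single oracle query suffices.\<close>

section \<open>Reductions by projections\<close>

text \<open>The entries of a query \<open>q n\<close> are positions in the list consisting of the inputs, the two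
  constants and the negated inputs.\<close>

definition literals :: "bool list \<Rightarrow> bool list" where
  "literals x = x @ [True, False] @ map Not x"

text \<open>The gates are ordered so that wire \<open>k\<close> carries entry \<open>k\<close> of
  \<open>literals x\<close>. Hence \<open>ws\<close> serves both as a list of positions and as the
  inputs of the oracle gate, which is wire \<open>2 * n + 2\<close>.\<close>

definition projection_circuit :: "nat \<Rightarrow> nat list \<Rightarrow> circuit" where
  "projection_circuit n ws =
     \<lparr>gates = [AndGate [], OrGate []] @ map NotGate [0..<n] @ [OracleGate ws],
      output_wire = 2 * n + 2\<rparr>"

text \<open>Appended values leave the input wires unchanged, and the negations read only those. The
  list \<open>ys\<close> makes room for the constants that precede the negations.\<close>

lemma foldl_snoc_not_gates:
  assumes "m \<le> length x"
  shows "foldl (\<lambda>vs g. vs @ [gate_value L vs g]) (x @ ys) (map NotGate [0..<m])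
           = x @ ys @ map Not (take m x)"
  using assms by (induction m) (auto simp: nth_append take_Suc_conv_app_nth)

lemma wire_values_projection_circuit:
  assumes "length x = n"
  shows "wire_values L (projection_circuit n ws) x
           = literals x @ [map ((!) (literals x)) ws \<in> L]"
  using foldl_snoc_not_gates[of n x L "[True, False]"] assms
  by (simp add: wire_values_def projection_circuit_def literals_def)

lemma accepts_projection_circuit:
  assumes "length x = n"
  shows "accepts L (projection_circuit n ws) x \<longleftrightarrow> map ((!) (literals x)) ws \<in> L"
proof -
  have "output_wire (projection_circuit n ws) = length (literals x)"
    using assms by (simp add: projection_circuit_def literals_def)
  then show ?thesis
    by (simp add: accepts_def wire_values_projection_circuit[OF assms])
qed

lemma foldl_depths_not_gates:
  assumes "m \<le> n"
  shows "foldl (\<lambda>ds g. ds @ [Suc (Max (insert 0 ((!) ds ` set (gate_inputs g))))])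
           (replicate n 0 @ ys) (map NotGate [0..<m]) = replicate n 0 @ ys @ replicate m 1"
  using assms by (induction m) (auto simp: nth_append replicate_append_same)

lemma wf_projection_circuit:
  assumes "\<And>w. w \<in> set ws \<Longrightarrow> w < 2 * n + 2"
  shows "wf_circuit n (projection_circuit n ws)"
  unfolding wf_circuit_def projection_circuit_def
  using assms by (auto simp: nth_append nth_Cons' less_Suc_eq simp flip: mult_2 split: if_splits)

text \<open>Every literal has depth at most 1, so the oracle gate has depth at most 2.\<close>

lemma circuit_depth_projection_circuit:
  assumes "\<And>w. w \<in> set ws \<Longrightarrow> w < 2 * n + 2"
  shows "circuit_depth n (projection_circuit n ws) \<le> 2"
proof -
  define ds :: "nat list" where "ds = replicate n 0 @ [1, 1] @ replicate n 1"
  have "wire_depths n (projection_circuit n ws) = ds @ [Suc (Max (insert 0 ((!) ds ` set ws)))]"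
    using foldl_depths_not_gates[of n n "[1, 1]"]
    by (simp add: wire_depths_def projection_circuit_def ds_def)
  moreover have ds: "d \<le> 1" if "d \<in> set ds" for d
    using that by (auto simp: ds_def)
  moreover have "ds ! w \<le> 1" if "w \<in> set ws" for w
    using assms[OF that] by (intro ds nth_mem) (simp add: ds_def)
  then have "Max (insert 0 ((!) ds ` set ws)) \<le> 1"
    by (subst Max_le_iff) auto
  ultimately show ?thesis
    unfolding circuit_depth_def by (subst Max_le_iff) (auto dest!: ds)
qed

lemma circuit_size_projection_circuit:
  "circuit_size (projection_circuit n ws) = 2 * n + 3 + length ws"
  by (simp add: circuit_size_def projection_circuit_def sum_list_triv comp_def)

lemma AC0_reduces_if_projection:
  assumes bound: "\<And>n w. w \<in> set (q n) \<Longrightarrow> w < 2 * n + 2"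
    and len: "\<And>n. length (q n) \<le> poly p n"
    and query: "\<And>x. x \<in> L \<longleftrightarrow> map ((!) (literals x)) (q (length x)) \<in> L'"
  shows "AC0_reduces L L'"
proof -
  \<comment> \<open>The summand \<open>3 + 2 * n\<close> pays for all gates and for the wires into
    the negations; \<open>p\<close> pays for the wires into the oracle gate.\<close>
  have "circuit_size (projection_circuit n (q n)) \<le> poly (p + [:3, 2:]) n" for n
    using len[of n] by (simp add: circuit_size_projection_circuit)
  moreover have "x \<in> L \<longleftrightarrow> accepts L' (projection_circuit n (q n)) x" if "length x = n" for n x
    using query[of x] that by (simp add: accepts_projection_circuit)
  ultimately show ?thesis
    unfolding AC0_reduces_def
    using wf_projection_circuit[OF bound] circuit_depth_projection_circuit[OF bound]
    by (intro exI[of _ "\<lambda>n. projection_circuit n (q n)"] exI[of _ 2] exI[of _ "p + [:3, 2:]"]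
        allI conjI impI)
qed

section \<open>Paths in a lattice column\<close>

definition consecutive :: "int set \<Rightarrow> int \<Rightarrow> int \<Rightarrow> bool" where
  "consecutive S a b \<longleftrightarrow> a \<in> S \<and> b \<in> S \<and> a < b \<and> S \<inter> {a<..<b} = {}"

definition path_edges :: "int set \<Rightarrow> point set set" where
  "path_edges S = {{(0, a), (0, b)} | a b. consecutive S a b}"

text \<open>The position of a vertex along the path, counted from 0 at the bottom. Its parity gives
  both the 2-colouring and the matching.\<close>

definition row_rank :: "int set \<Rightarrow> int \<Rightarrow> nat" where
  "row_rank S a = card (S \<inter> {..<a})"

lemma row_rank_consecutive:
  assumes "finite S" "consecutive S a b"
  shows "row_rank S b = Suc (row_rank S a)"
proof -
  have "S \<inter> {..<b} = insert a (S \<inter> {..<a})"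
    using assms(2) by (fastforce simp: consecutive_def)
  then show ?thesis
    using assms(1) by (simp add: row_rank_def)
qed

lemma consecutive_unique_right: "consecutive S a b \<Longrightarrow> consecutive S a c \<Longrightarrow> b = c"
  unfolding consecutive_def disjoint_iff greaterThanLessThan_iff by (meson linorder_neqE)

lemma consecutive_unique_left: "consecutive S a c \<Longrightarrow> consecutive S b c \<Longrightarrow> a = b"
  unfolding consecutive_def disjoint_iff greaterThanLessThan_iff by (meson linorder_neqE)

lemma ex_consecutive_right:
  assumes "finite S" "a \<in> S" "c \<in> S" "a < c"
  obtains b where "consecutive S a b"
proof -
  let ?T = "S \<inter> {a<..}"
  have T: "finite ?T" "?T \<noteq> {}"
    using assms by auto
  have "S \<inter> {a<..<Min ?T} = {}"
    using Min_le[OF T(1)] by fastforce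
  then have "consecutive S a (Min ?T)"
    using Min_in[OF T] assms(2) by (simp add: consecutive_def)
  then show thesis ..
qed

lemma ex_consecutive_left:
  assumes "finite S" "b \<in> S" "c \<in> S" "c < b"
  obtains a where "consecutive S a b"
proof -
  let ?T = "S \<inter> {..<b}"
  have T: "finite ?T" "?T \<noteq> {}"
    using assms by auto
  have "S \<inter> {Max ?T<..<b} = {}"
    using Max_ge[OF T(1)] by fastforce
  then have "consecutive S (Max ?T) b"
    using Max_in[OF T] assms(2) by (simp add: consecutive_def)
  then show thesis ..
qed

section \<open>The column path as a bipartite grid layered planar graph\<close>

lemma simple_graph_path:
  assumes "finite S"
  shows "simple_graph (Pair 0 ` S) (path_edges S)"
  using assms by (auto simp: simple_graph_def path_edges_def consecutive_def card_insert_if)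

text \<open>The colour classes are the vertices of even and of odd rank; ranks of neighbours differ
  by 1.\<close>

lemma bipartite_path:
  assumes "finite S"
  shows "bipartite (Pair 0 ` S) (path_edges S)"
proof -
  define A B where "A = Pair (0::int) ` {a \<in> S. even (row_rank S a)}"
    and "B = Pair (0::int) ` {a \<in> S. odd (row_rank S a)}"
  have "\<exists>u\<in>A. \<exists>v\<in>B. {(0, a), (0, b)} = {u, v}" if "consecutive S a b" for a b
  proof -
    have "row_rank S b = Suc (row_rank S a)" "a \<in> S" "b \<in> S"
      using that row_rank_consecutive[OF assms] by (auto simp: consecutive_def)
    then have "(0, a) \<in> A \<and> (0, b) \<in> B \<or> (0, b) \<in> A \<and> (0, a) \<in> B"
      by (cases "even (row_rank S a)") (simp_all add: A_def B_def)
    then show ?thesis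
      by (metis insert_commute)
  qed
  then have "\<forall>e\<in>path_edges S. \<exists>u\<in>A. \<exists>v\<in>B. e = {u, v}"
    unfolding path_edges_def by blast
  moreover have "A \<union> B = Pair 0 ` S" "A \<inter> B = {}"
    by (auto simp: A_def B_def)
  ultimately show ?thesis
    unfolding bipartite_def by blast
qed

text \<open>This reduces planarity to comparing intervals of rows.\<close>

lemma segment_column:
  assumes "z \<in> segment {(0, a), (0, b)}" "a \<le> b"
  shows "fst z = 0" "real_of_int a \<le> snd z" "snd z \<le> real_of_int b"
proof -
  obtain u v where "0 \<le> u" "0 \<le> v" "u + v = 1"
    and z: "z = u *\<^sub>R (0, real_of_int a) + v *\<^sub>R (0, real_of_int b)"
    using assms(1) by (auto simp: segment_def plane_point_def convex_hull_2)
  then have "snd z \<in> closed_segment (real_of_int a) (real_of_int b)"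
    \<comment> \<open>\<open>closed_segment\<close> is parametrised by the weight of its second
      endpoint, hence the witness \<open>v\<close>.\<close>
    by (auto simp: closed_segment_def intro!: exI[of _ v])
  then show "real_of_int a \<le> snd z" "snd z \<le> real_of_int b"
    using assms(2) by (auto simp: closed_segment_eq_real_ivl)
  show "fst z = 0"
    using z by simp
qed

text \<open>If \<open>a < c\<close>, then \<open>c\<close>, being in \<open>S\<close>, cannot lie
  strictly between \<open>a\<close> and \<open>b\<close>; the case \<open>c < a\<close> is
  symmetric.\<close>

lemma consecutive_less_cases:
  assumes "consecutive S a b" "consecutive S c d" "a \<noteq> c"
  shows "b \<le> c \<or> d \<le> a"
  using assms unfolding consecutive_def disjoint_iff greaterThanLessThan_iff
  by (meson linorder_neqE linorder_not_less)

lemma planar_embedded_path: "planar_embedded (Pair 0 ` S) (path_edges S)"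
proof -
  have inter: "segment {(0, a), (0, b)} \<inter> segment {(0, c), (0, d)}
      \<subseteq> plane_point ` ({(0, a), (0, b)} \<inter> {(0, c), (0, d)})"
    if ab: "consecutive S a b" and cd: "consecutive S c d" and ne: "a \<noteq> c" for a b c d
  proof
    fix z assume z: "z \<in> segment {(0, a), (0, b)} \<inter> segment {(0, c), (0, d)}"
    have le: "a \<le> b" "c \<le> d"
      using ab cd by (auto simp: consecutive_def)
    have bounds: "fst z = 0" "real_of_int a \<le> snd z" "snd z \<le> real_of_int b"
      "real_of_int c \<le> snd z" "snd z \<le> real_of_int d"
      using z segment_column[of z a b] segment_column[of z c d] le by simp_all
    from consecutive_less_cases[OF ab cd ne]
    show "z \<in> plane_point ` ({(0, a), (0, b)} \<inter> {(0, c), (0, d)})"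
    proof
      assume "b \<le> c"
      \<comment> \<open>The row of \<open>z\<close> is at most \<open>b\<close> and at least
        \<open>c\<close>, so the segments meet only in a shared endpoint.\<close>
      then have "b = c" "snd z = real_of_int b"
        using bounds by linarith+
      then show ?thesis
        using bounds(1) by (auto simp: plane_point_def prod_eq_iff)
    next
      assume "d \<le> a"
      then have "d = a" "snd z = real_of_int a"
        using bounds by linarith+
      then show ?thesis
        using bounds(1) by (auto simp: plane_point_def prod_eq_iff)
    qed
  qed
  have inc: "v = a \<or> v = b"
    if ab: "consecutive S a b" and v: "v \<in> S" "plane_point (0, v) \<in> segment {(0, a), (0, b)}"
    for a b v
  proof -
    have "a \<le> v" "v \<le> b"
      using segment_column[OF v(2)] ab by (auto simp: consecutive_def plane_point_def)
    then show ?thesis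
      using ab v(1) by (force simp: consecutive_def disjoint_iff)
  qed
  have "segment e \<inter> segment f \<subseteq> plane_point ` (e \<inter> f)"
    if "e \<in> path_edges S" "f \<in> path_edges S" "e \<noteq> f" for e f
  proof -
    from that obtain a b c d where ab: "consecutive S a b" and cd: "consecutive S c d"
      and ef: "e = {(0, a), (0, b)}" "f = {(0, c), (0, d)}"
      unfolding path_edges_def by blast
    \<comment> \<open>The lower end determines the edge, so distinct edges have distinct lower
      ends.\<close>
    then have "a \<noteq> c"
      using consecutive_unique_right that(3) by blast
    then show ?thesis
      unfolding ef by (rule inter[OF ab cd])
  qed
  moreover have "v \<in> e"
    if "e \<in> path_edges S" "v \<in> Pair 0 ` S" "plane_point v \<in> segment e" for e v
    using that inc unfolding path_edges_def by blast
  ultimately show ?thesis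
    unfolding planar_embedded_def by blast
qed

lemma grid_layered_planar_path:
  assumes "finite S"
  shows "grid_layered_planar (Pair 0 ` S) (path_edges S)"
  unfolding grid_layered_planar_def
  using simple_graph_path[OF assms] planar_embedded_path by (auto simp: path_edges_def)

section \<open>Perfect matchings and the parity of the number of vertices\<close>

lemma perfect_matching_path:
  assumes "finite S" "even (card S)"
  shows "\<exists>M. perfect_matching (Pair 0 ` S) (path_edges S) M"
proof -
  \<comment> \<open>Each vertex of even rank is matched with its successor.\<close>
  define M where "M = {{(0::int, a), (0, b)} | a b. consecutive S a b \<and> even (row_rank S a)}"
  \<comment> \<open>The parity of the rank of \<open>v\<close> tells whether \<open>v\<close> is the
    lower or the upper end of a matching edge, and either end determines the edge.\<close>
  have uniq: "e = {(0, a), (0, b)}"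
    if "e \<in> M" "(0, v) \<in> e" "consecutive S a b" "even (row_rank S a)" "v = a \<or> v = b" for e v a b
  proof -
    from that(1) obtain c d where cd: "e = {(0, c), (0, d)}" "consecutive S c d" "even (row_rank S c)"
      by (auto simp: M_def)
    then have "odd (row_rank S b)" "odd (row_rank S d)"
      using row_rank_consecutive[OF assms(1)] that by auto
    then have "v = a \<and> v = c \<or> v = b \<and> v = d"
      using cd that by auto
    then show ?thesis
      using cd that consecutive_unique_left consecutive_unique_right by metis
  qed
  have ex: "\<exists>a b. consecutive S a b \<and> even (row_rank S a) \<and> (v = a \<or> v = b)" if v: "v \<in> S" for v
  proof (cases "even (row_rank S v)")
    case True
    \<comment> \<open>A topmost vertex has rank \<open>card S - 1\<close>, which is odd.\<close>
    have "\<exists>c\<in>S. v < c"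
    proof (rule ccontr)
      assume "\<not> (\<exists>c\<in>S. v < c)"
      then have "S = insert v (S \<inter> {..<v})"
        using v by force
      then have "card S = Suc (row_rank S v)"
        using assms(1) by (metis IntE card_insert_disjoint finite_Int lessThan_iff order_less_irrefl row_rank_def)
      then show False
        using True assms(2) by simp
    qed
    then show ?thesis
      using True ex_consecutive_right[OF assms(1) v] by blast
  next
    case False
    \<comment> \<open>An odd rank is nonzero, so some vertex lies below \<open>v\<close>.\<close>
    then have "S \<inter> {..<v} \<noteq> {}"
      unfolding row_rank_def by (metis card.empty even_zero)
    then obtain a where "consecutive S a v"
      using ex_consecutive_left[OF assms(1) v] by blast
    then show ?thesis
      using False row_rank_consecutive[OF assms(1)] by fastforce
  qed
  have "\<exists>!e. e \<in> M \<and> (0, v) \<in> e" if v: "v \<in> S" for v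
  proof -
    from ex[OF v] obtain a b where ab: "consecutive S a b" "even (row_rank S a)" "v = a \<or> v = b"
      by blast
    show ?thesis
    proof (rule ex1I)
      show "{(0, a), (0, b)} \<in> M \<and> (0, v) \<in> {(0, a), (0, b)}"
        using ab by (auto simp: M_def)
      show "e = {(0, a), (0, b)}" if "e \<in> M \<and> (0, v) \<in> e" for e
        using that ab uniq by blast
    qed
  qed
  moreover have "M \<subseteq> path_edges S"
    by (auto simp: M_def path_edges_def)
  ultimately have "perfect_matching (Pair 0 ` S) (path_edges S) M"
    by (auto simp: perfect_matching_def)
  then show ?thesis ..
qed

text \<open>The matching edges partition \<open>V\<close> into sets of size 2. This holds for any
  simple graph, not just for paths.\<close>

lemma perfect_matching_even_card:
  assumes "simple_graph V E" "perfect_matching V E M"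
  shows "even (card V)"
proof -
  have M: "e \<subseteq> V" "card e = 2" if "e \<in> M" for e
    using that assms by (auto simp: simple_graph_def perfect_matching_def)
  have "\<Union>M = V"
    using M(1) assms(2) unfolding perfect_matching_def by blast
  moreover have "pairwise disjnt M"
  proof (intro pairwiseI)
    fix e f assume ef: "e \<in> M" "f \<in> M" "e \<noteq> f"
    have False if "v \<in> e" "v \<in> f" for v
      using that ef M(1)[OF ef(1)] assms(2) unfolding perfect_matching_def by blast
    then show "disjnt e f"
      by (auto simp: disjnt_iff)
  qed
  \<comment> \<open>Edges are finite because they have cardinality 2, whereas infinite sets have
    cardinality 0.\<close>
  then have "card (\<Union>M) = (\<Sum>e\<in>M. card e)"
    by (rule card_Union_disjoint) (metis M(2) card.infinite zero_neq_numeral)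
  ultimately show ?thesis
    using M(2) by simp
qed

section \<open>The query for Parity\<close>

definition path_rows :: "bool list \<Rightarrow> int set" where
  "path_rows x = {r. 0 \<le> r \<and> r \<le> 2 * int (length x) \<and> (odd r \<longrightarrow> \<not> x ! nat (r div 2))}"

lemma nat_div_2_less:
  assumes "0 \<le> a" "a < 2 * int n"
  shows "nat (a div 2) < n"
  using assms by (simp add: nat_less_iff)

text \<open>An odd row differs from the top row \<open>2 * n\<close>, so the input position it
  refers to is in range.\<close>

lemma nat_div_2_less_odd:
  assumes "0 \<le> a" "a \<le> 2 * int n" "odd a"
  shows "nat (a div 2) < n"
proof (rule nat_div_2_less)
  have "a \<noteq> 2 * int n"
    using assms(3) by auto
  then show "a < 2 * int n"
    using assms(2) by simp
qed fact

lemma finite_path_rows: "finite (path_rows x)"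
  by (rule finite_subset[of _ "{0..2 * int (length x)}"]) (auto simp: path_rows_def)

text \<open>There are \<open>n + 1\<close> even rows (\<open>?A\<close>) and one odd row per false
  input bit (\<open>?B\<close>); false and true bits together number \<open>n\<close>.\<close>

lemma card_path_rows: "even (card (path_rows x)) \<longleftrightarrow> odd (count_list x True)"
proof -
  let ?n = "length x"
  let ?Z = "{i. i < ?n \<and> \<not> x ! i}" and ?O = "{i. i < ?n \<and> x ! i}"
  let ?A = "(\<lambda>i. 2 * int i) ` {..?n}" and ?B = "(\<lambda>i. 2 * int i + 1) ` ?Z"
  have "path_rows x = ?A \<union> ?B"
  proof (rule set_eqI)
    fix r :: int
    show "r \<in> path_rows x \<longleftrightarrow> r \<in> ?A \<union> ?B"
    proof (cases "even r")
      case True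
      then obtain k where "r = 2 * k" ..
      then show ?thesis
        by (auto simp: path_rows_def image_iff intro!: bexI[of _ "nat k"])
    next
      case False
      then obtain k where "r = 2 * k + 1"
        by (rule oddE)
      then show ?thesis
        by (auto simp: path_rows_def image_iff intro!: exI[of _ "nat k"]) presburger
    qed
  qed
  moreover have "?A \<inter> ?B = {}"
    by (auto simp: image_iff) presburger
  then have "card (?A \<union> ?B) = card ?A + card ?B"
    by (simp add: card_Un_disjoint)
  moreover have "card ?A = Suc ?n" "card ?B = card ?Z"
    by (simp_all add: card_image inj_on_def)
  moreover have "card ?Z + card ?O = ?n"
  proof -
    have "card (?Z \<union> ?O) = card ?Z + card ?O"
      by (rule card_Un_disjoint) auto
    moreover have "?Z \<union> ?O = {..<?n}"
      by auto
    ultimately show ?thesis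
      by simp
  qed
  moreover have "card ?O = count_list x True"
    by (simp add: count_list_eq_length_filter length_filter_conv_card)
  ultimately show ?thesis
    by presburger
qed

text \<open>In \<open>literals x\<close>, position \<open>n\<close> is the constant true and
  position \<open>n + 2 + i\<close> the negation of input \<open>i\<close>, which decides row
  \<open>2 * i + 1\<close>.\<close>

definition vertex_literal :: "nat \<Rightarrow> point \<Rightarrow> nat" where
  "vertex_literal n p = (if even (snd p) then n else n + 2 + nat (snd p div 2))"

text \<open>Of two adjacent rows one is odd, and the edge exists iff that row is present. Even rows
  at distance 2 are joined iff the odd row between them is absent, that is, iff the input bit is
  true. Position \<open>n + 1\<close> is the constant false.\<close>

definition edge_literal :: "nat \<Rightarrow> point \<times> point \<Rightarrow> nat" where
  "edge_literal n e =
     (let a = min (snd (fst e)) (snd (snd e)); b = max (snd (fst e)) (snd (snd e)) in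
      if b = a + 1 then n + 2 + nat (a div 2)
      else if b = a + 2 \<and> even a then nat (a div 2)
      else n + 1)"

text \<open>The grid size depends only on \<open>n\<close>, so the unary header consists of
  constants: one column, then \<open>2 * n + 1\<close> rows, each closed by false.\<close>

definition parity_query :: "nat \<Rightarrow> nat list" where
  "parity_query n = (let ps = grid_points 1 (2 * n + 1) in
     [n, n + 1] @ replicate (2 * n + 1) n @ [n + 1] @
     map (vertex_literal n) ps @ map (edge_literal n) (List.product ps ps))"

section \<open>Correctness of the query: it spells out the encoding of the path\<close>

lemma literals_nth [simp]:
  "literals x ! length x"
  "\<not> literals x ! Suc (length x)"
  "i < length x \<Longrightarrow> literals x ! i \<longleftrightarrow> x ! i"
  "i < length x \<Longrightarrow> literals x ! Suc (Suc (length x + i)) \<longleftrightarrow> \<not> x ! i"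
  by (auto simp: literals_def nth_append)

lemma set_grid_points_column: "set (grid_points 1 w) = Pair 0 ` {0..<int w}"
proof -
  have "set (grid_points 1 w) = Pair 0 ` int ` {0..<w}"
    by (auto simp: grid_points_def)
  then show ?thesis
    by (simp add: image_int_atLeastLessThan)
qed

lemma length_grid_points: "length (grid_points l w) = l * w"
  by (simp add: grid_points_def)

lemma path_rows_subset_grid:
  "Pair 0 ` path_rows x \<subseteq> set (grid_points 1 (2 * length x + 1))"
  unfolding set_grid_points_column by (auto simp: path_rows_def)

lemma vertex_literal_path:
  assumes "p \<in> set (grid_points 1 (2 * length x + 1))"
  shows "literals x ! vertex_literal (length x) p \<longleftrightarrow> p \<in> Pair 0 ` path_rows x"
proof -
  obtain r where r: "p = (0, r)" "0 \<le> r" "r \<le> 2 * int (length x)"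
    using assms unfolding set_grid_points_column by auto
  have "nat (r div 2) < length x" if "odd r"
    using that r by (intro nat_div_2_less_odd)
  then show ?thesis
    using r by (auto simp: vertex_literal_def path_rows_def)
qed

text \<open>Even rows are always present, so consecutive rows are at distance at most 2.\<close>

lemma consecutive_path_rows:
  assumes "0 \<le> a" "b \<le> 2 * int (length x)" "a < b"
  shows "consecutive (path_rows x) a b \<longleftrightarrow>
    b = a + 1 \<and> \<not> x ! nat (a div 2) \<or> b = a + 2 \<and> even a \<and> x ! nat (a div 2)"
proof
  assume c: "consecutive (path_rows x) a b"
  have mem: "a \<in> path_rows x" "b \<in> path_rows x" and gap: "\<And>r. r \<in> path_rows x \<Longrightarrow> a < r \<Longrightarrow> \<not> r < b"
    using c by (auto simp: consecutive_def)
  show "b = a + 1 \<and> \<not> x ! nat (a div 2) \<or> b = a + 2 \<and> even a \<and> x ! nat (a div 2)"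
  proof (cases "even a")
    case True
    \<comment> \<open>Were the even row \<open>a + 2\<close> below \<open>b\<close>, it would be a
      vertex inside the gap.\<close>
    then have "a + 2 \<in> path_rows x" if "a + 2 < b"
      using that assms by (auto simp: path_rows_def)
    then have "\<not> a + 2 < b"
      using gap by force
    then consider "b = a + 1" | "b = a + 2"
      using assms by linarith
    then show ?thesis
    proof cases
      case 1
      then show ?thesis
        using mem(2) True by (auto simp: path_rows_def)
    next
      case 2
      then have "a + 1 \<notin> path_rows x"
        using gap by force
      then show ?thesis
        using 2 True assms by (auto simp: path_rows_def)
    qed
  next
    case False
    \<comment> \<open>Here \<open>a + 1\<close> is even, hence present, which leaves no other
      candidate for \<open>b\<close>.\<close>
    then have "a + 1 \<in> path_rows x"
      using assms by (auto simp: path_rows_def)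
    then have "b = a + 1"
      using gap[of "a + 1"] assms by linarith
    then show ?thesis
      using mem(1) False by (auto simp: path_rows_def)
  qed
next
  assume "b = a + 1 \<and> \<not> x ! nat (a div 2) \<or> b = a + 2 \<and> even a \<and> x ! nat (a div 2)"
  then show "consecutive (path_rows x) a b"
  proof
    assume b: "b = a + 1 \<and> \<not> x ! nat (a div 2)"
    \<comment> \<open>If \<open>a\<close> is even, the odd row is \<open>b\<close>, and
      \<open>a div 2\<close> still names the bit governing it.\<close>
    have "(a + 1) div 2 = a div 2" if "even a"
      using that by presburger
    then show ?thesis
      using b assms by (auto simp: consecutive_def path_rows_def)
  next
    assume b: "b = a + 2 \<and> even a \<and> x ! nat (a div 2)"
    have "(a + 1) div 2 = a div 2"
      using b by presburger
    then have "a + 1 \<notin> path_rows x"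
      using b by (auto simp: path_rows_def)
    moreover have "{a<..<b} = {a + 1}"
      using b by auto
    ultimately show ?thesis
      using b assms by (auto simp: consecutive_def path_rows_def)
  qed
qed

text \<open>Edges are unordered, whereas \<open>consecutive\<close> wants the lower row first. For
  \<open>a = b\<close> both sides are false.\<close>

lemma path_edges_iff:
  "{(0, a), (0, b)} \<in> path_edges S \<longleftrightarrow> consecutive S (min a b) (max a b)"
proof
  assume "{(0, a), (0, b)} \<in> path_edges S"
  then obtain c d where cd: "{(0::int, a), (0, b)} = {(0, c), (0, d)}" "consecutive S c d"
    unfolding path_edges_def by blast
  moreover from cd(2) have "c < d"
    by (simp add: consecutive_def)
  ultimately show "consecutive S (min a b) (max a b)"
    by (auto simp: doubleton_eq_iff)
next
  assume "consecutive S (min a b) (max a b)"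
  moreover have "{(0::int, a), (0, b)} = {(0, min a b), (0, max a b)}"
    by (auto simp: min_def max_def)
  ultimately show "{(0, a), (0, b)} \<in> path_edges S"
    unfolding path_edges_def by blast
qed

lemma edge_literal_path:
  assumes "p \<in> set (grid_points 1 (2 * length x + 1))" "q \<in> set (grid_points 1 (2 * length x + 1))"
  shows "literals x ! edge_literal (length x) (p, q) \<longleftrightarrow> {p, q} \<in> path_edges (path_rows x)"
proof -
  obtain r s where rs: "p = (0, r)" "q = (0, s)"
    "0 \<le> r" "r \<le> 2 * int (length x)" "0 \<le> s" "s \<le> 2 * int (length x)"
    using assms unfolding set_grid_points_column by auto
  define a b where "a = min r s" and "b = max r s"
  have ab: "0 \<le> a" "b \<le> 2 * int (length x)" "a \<le> b"
    using rs by (auto simp: a_def b_def)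
  have lit: "edge_literal (length x) (p, q) =
      (if b = a + 1 then length x + 2 + nat (a div 2)
       else if b = a + 2 \<and> even a then nat (a div 2) else length x + 1)"
    by (simp add: edge_literal_def rs(1,2) a_def b_def Let_def)
  have edge: "{p, q} \<in> path_edges (path_rows x) \<longleftrightarrow> consecutive (path_rows x) a b"
    by (simp add: rs(1,2) path_edges_iff a_def b_def)
  show ?thesis
  proof (cases "a < b")
    case True
    have "nat (a div 2) < length x" if "b = a + 1 \<or> b = a + 2"
      using that ab by (intro nat_div_2_less) auto
    then show ?thesis
      unfolding edge lit consecutive_path_rows[OF ab(1,2) True] by auto
  next
    case False
    \<comment> \<open>The two rows coincide: the literal is the constant false, and the path has no
      loops.\<close>
    then show ?thesis
      unfolding edge lit using ab by (simp add: consecutive_def)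
  qed
qed

lemma parity_query_encodes_path:
  "map ((!) (literals x)) (parity_query (length x)) =
     encode_grid_graph 1 (2 * length x + 1) (Pair 0 ` path_rows x) (path_edges (path_rows x))"
proof -
  define ps where "ps = grid_points 1 (2 * length x + 1)"
  have "map ((!) (literals x)) (map (vertex_literal (length x)) ps)
      = map (\<lambda>p. p \<in> Pair 0 ` path_rows x) ps"
    using vertex_literal_path[of _ x, folded ps_def] by simp
  moreover have "map ((!) (literals x)) (map (edge_literal (length x)) (List.product ps ps))
      = map (\<lambda>(p, q). {p, q} \<in> path_edges (path_rows x)) (List.product ps ps)"
    using edge_literal_path[of _ x, folded ps_def] by fastforce
  ultimately show ?thesis
    unfolding parity_query_def encode_grid_graph_def Let_def ps_def[symmetric] map_append
    by (simp only: map_replicate list.map literals_nth Suc_eq_plus1[symmetric] simp_thms)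
      simp
qed

section \<open>Unique decoding and membership in \<open>BGGM\<close>\<close>

lemma replicate_True_False_eq_iff:
  "replicate m True @ False # xs = replicate n True @ False # ys \<longleftrightarrow> m = n \<and> xs = ys"
proof (induction m arbitrary: n)
  case 0
  then show ?case by (cases n) auto
next
  case (Suc m)
  then show ?case by (cases n) auto
qed

text \<open>The unary header fixes the grid, after which the vertex bits can be compared point by
  point; the inclusions exclude vertices outside the grid.\<close>

lemma encode_grid_graph_vertices:
  assumes "encode_grid_graph l w V E = encode_grid_graph l' w' V' E'"
    and "V \<subseteq> set (grid_points l w)" "V' \<subseteq> set (grid_points l' w')"
  shows "V = V'"
proof -
  have "l = l'" "w = w'"
    and "map (\<lambda>p. p \<in> V) (grid_points l w) = map (\<lambda>p. p \<in> V') (grid_points l' w')"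
    using assms(1) by (auto simp: encode_grid_graph_def replicate_True_False_eq_iff)
  then show ?thesis
    using assms(2,3) by auto
qed

text \<open>Membership only provides some graph with the same code. Its vertex set is that of the
  path, so its perfect matching makes \<open>card S\<close> even; conversely the path itself is the
  witness.\<close>

lemma encode_path_in_BGGM:
  assumes "finite S" and sub: "Pair 0 ` S \<subseteq> set (grid_points l w)"
  shows "encode_grid_graph l w (Pair 0 ` S) (path_edges S) \<in> BGGM \<longleftrightarrow> even (card S)"
proof
  assume "even (card S)"
  then show "encode_grid_graph l w (Pair 0 ` S) (path_edges S) \<in> BGGM"
    unfolding BGGM_def mem_Collect_eq
    using assms grid_layered_planar_path bipartite_path perfect_matching_path
    by (intro exI[of _ l] exI[of _ w] exI[of _ "Pair 0 ` S"] exI[of _ "path_edges S"])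
      simp
next
  assume "encode_grid_graph l w (Pair 0 ` S) (path_edges S) \<in> BGGM"
  then obtain l' w' V' E' M
    where eq: "encode_grid_graph l w (Pair 0 ` S) (path_edges S) = encode_grid_graph l' w' V' E'"
      and V': "V' \<subseteq> set (grid_points l' w')" "simple_graph V' E'" "perfect_matching V' E' M"
    unfolding BGGM_def grid_layered_planar_def mem_Collect_eq
    by (elim exE conjE) (rule that; assumption)
  have "card S = card V'"
    using encode_grid_graph_vertices[OF eq sub V'(1)] by (auto simp: card_image inj_on_def)
  then show "even (card S)"
    using perfect_matching_even_card V'(2,3) by simp
qed

section \<open>Bounds on the query, and the reduction\<close>

lemma parity_query_bound:
  assumes "w \<in> set (parity_query n)"
  shows "w < 2 * n + 2"
proof -
  have v: "vertex_literal n (0, r) < 2 * n + 2" if "0 \<le> r" "r < 2 * int n + 1" for r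
    using that nat_div_2_less_odd[of r n] by (auto simp: vertex_literal_def)
  have e: "edge_literal n ((0, r), (0, s)) < 2 * n + 2"
    if "0 \<le> r" "r < 2 * int n + 1" "0 \<le> s" "s < 2 * int n + 1" for r s
  proof -
    define a b where "a = min r s" and "b = max r s"
    have "0 \<le> a" "b \<le> 2 * int n"
      using that by (auto simp: a_def b_def)
    then have "nat (a div 2) < n" if "b = a + 1 \<or> b = a + 2"
      using that by (intro nat_div_2_less) auto
    then show ?thesis
      by (auto simp: edge_literal_def Let_def simp flip: a_def b_def)
  qed
  show ?thesis
    using assms v e unfolding parity_query_def Let_def
    by (auto simp: set_grid_points_column[of "2 * n + 1", simplified])
qed

text \<open>The header contributes \<open>2 * n + 4\<close> entries, the vertices
  \<open>2 * n + 1\<close>, and the adjacency matrix the square of \<open>2 * n + 1\<close>.\<close>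

lemma length_parity_query: "length (parity_query n) = poly [:6, 8, 4:] n"
  by (simp add: parity_query_def Let_def length_grid_points algebra_simps)

theorem theorem7:
  shows "AC0_reduces Parity BGGM"
proof (rule AC0_reduces_if_projection)
  show "length (parity_query n) \<le> poly [:6, 8, 4:] n" for n
    by (simp only: length_parity_query order_refl)
  show "x \<in> Parity \<longleftrightarrow> map ((!) (literals x)) (parity_query (length x)) \<in> BGGM" for x
    using encode_path_in_BGGM[OF finite_path_rows path_rows_subset_grid] card_path_rows
    by (simp only: parity_query_encodes_path Parity_def mem_Collect_eq)
qed (rule parity_query_bound)

end
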